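(* Let $\dot y=f(y)$ be an ODE on $\mathbb{R}^m$ with independent first integrals $H_1,\dots,H_q$ ($q\ge1$), let $\overline{\nabla}$ be a fixed discrete gradient operator with associated discrete tangent spaces $T_{(v,u)}M$, and let $\mathcal{P}(v,u)$ be a projection operator of $\mathbb{R}^m$ onto $T_{(v,u)}M$ depending smoothly on $(v,u)$. Let $\phi_h$ be the discrete flow of a one-step method of order $p$, and let $\psi_h$ be the increment function of a method $y^{n+1}=y^n+h\psi_h(y^n,y^{n+1})$ of order $p$, that is, for every exact solution $y(\cdot)$ of the ODE and every $t$, as $h\to0$, $$y(t+h)-\phi_h(y(t))=\mathcal{O}(h^{p+1}),\qquad y(t+h)-y(t)-h\psi_h(y(t),y(t+h))=\mathcal{O}(h^{p+1}).$$ Then the projection scheme $$u^{n+1}=\phi_h(y^n),\qquad y^{n+1}=y^n+\mathcal{P}(y^n,y^{n+1})(u^{n+1}-y^n)$$ and the projection scheme $$y^{n+1}=y^n+h\,\mathcal{P}(y^n,y^{n+1})\,\psi_h(y^n,y^{n+1})$$ are both of order $p$; that is, for every exact solution $y(\cdot)$ and every $t$, as $h\to 0$, $$y(t+h)-y(t)-\mathcal{P}(y(t),y(t+h))\,(u^{n+1}-y(t))=\mathcal{O}(h^{p+1})\quad\text{with } u^{n+1}=\phi_h(y(t)),$$ and $$y(t+h)-y(t)-h\,\mathcal{P}(y(t),y(t+h))\,\psi_h(y(t),y(t+h))=\mathcal{O}(h^{p+1}).$$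
   Context: A discrete gradient of a differentiable function $H:\mathbb{R}^m\to\mathbb{R}$ is a continuous map $\overline{\nabla}H:\mathbb{R}^m\times\mathbb{R}^m\to\mathbb{R}^m$ such that for all $u,v\in\mathbb{R}^m$ $$H(u)-H(v)=\overline{\nabla}H(v,u)^{\top}(u-v),\qquad \overline{\nabla}H(u,u)=\nabla H(u).$$ A discrete gradient operator $\overline{\nabla}$ assigns to each of the functions considered one such map; it is fixed throughout and otherwise arbitrary. The discrete tangent space at $(v,u)\in\mathbb{R}^m\times\mathbb{R}^m$ associated with $H_1,\dots,H_q$ is $$T_{(v,u)}M=\{\eta\in\mathbb{R}^m:\ \langle\overline{\nabla}H_j(v,u),\eta\rangle=0,\ 1\le j\le q\},$$ where $\langle\cdot,\cdot\rangle$ is the Euclidean inner product. A first integral of $\dot y=f(y)$ is a function that is constant along every solution; independence of $H_1,\dots,H_q$ means that their gradients are linearly independent. A projection operator onto a subspace $V$ is a linear map $P$ with $P^2=P$ and image $V$. The operators $\mathcal{P}(v,u)$ are only needed, and only assumed to be defined, for $(v,u)$ in a neighbourhood of the diagonal $\{(y,y)\}$. The vector field $f$ is assumed smooth. *)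

theory Defs
  imports "HOL-Analysis.Analysis" "HOL-Library.Landau_Symbols"
begin

text \<open>Derivatives are taken in every direction, so on an open set \<open>Ck_on k S f\<close> says that all
  directional derivatives of \<open>f\<close> of order at most \<open>k\<close> exist and are continuous.\<close>

primrec Ck_on :: "nat \<Rightarrow> 'a::real_normed_vector set \<Rightarrow> ('a \<Rightarrow> 'b::real_normed_vector) \<Rightarrow> bool" where
  "Ck_on 0 S f \<longleftrightarrow> continuous_on S f"
| "Ck_on (Suc k) S f \<longleftrightarrow>
     (\<forall>x\<in>S. f differentiable (at x)) \<and> (\<forall>v. Ck_on k S (\<lambda>x. frechet_derivative f (at x) v))"

definition smooth_on :: "'a::real_normed_vector set \<Rightarrow> ('a \<Rightarrow> 'b::real_normed_vector) \<Rightarrow> bool" where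
  "smooth_on S f \<longleftrightarrow> (\<forall>k. Ck_on k S f)"

definition grad :: "('a::real_inner \<Rightarrow> real) \<Rightarrow> 'a \<Rightarrow> 'a" where
  "grad H y = (THE g. GDERIV H y :> g)"

lemma grad_eq:
  assumes "GDERIV H y :> g"
  shows "grad H y = g"
  unfolding grad_def
proof (rule the_equality)
  show "g' = g" if "GDERIV H y :> g'" for g'
  proof -
    have "(\<lambda>h. h \<bullet> g') = (\<lambda>h. h \<bullet> g)"
      using that assms unfolding gderiv_def by (rule has_derivative_unique)
    then have "(g' - g) \<bullet> g' = (g' - g) \<bullet> g"
      by (rule fun_cong)
    then have "(g' - g) \<bullet> (g' - g) = 0"
      by (simp add: inner_diff_right)
    then show ?thesis
      by simp
  qed
qed (rule assms)

definition discrete_gradient :: "('a::real_inner \<Rightarrow> real) \<Rightarrow> ('a \<Rightarrow> 'a \<Rightarrow> 'a) \<Rightarrow> bool" where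
  "discrete_gradient H D \<longleftrightarrow>
     (\<forall>u. H differentiable (at u)) \<and>
     continuous_on UNIV (\<lambda>(v, u). D v u) \<and>
     (\<forall>u v. H u - H v = D v u \<bullet> (u - v)) \<and>
     (\<forall>u. D u u = grad H u)"

definition discrete_tangent_space ::
  "(('a::real_inner \<Rightarrow> real) \<Rightarrow> 'a \<Rightarrow> 'a \<Rightarrow> 'a) \<Rightarrow> (nat \<Rightarrow> 'a \<Rightarrow> real) \<Rightarrow> nat \<Rightarrow> 'a \<Rightarrow> 'a \<Rightarrow> 'a set" where
  "discrete_tangent_space DG H q v u = {\<eta>. \<forall>j\<in>{1..q}. DG (H j) v u \<bullet> \<eta> = 0}"

text \<open>Only the values of \<open>y\<close> on the open interval \<open>I\<close> matter.\<close>

definition ode_solution :: "('a::real_normed_vector \<Rightarrow> 'a) \<Rightarrow> real set \<Rightarrow> (real \<Rightarrow> 'a) \<Rightarrow> bool" where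
  "ode_solution f I y \<longleftrightarrow>
     open I \<and> is_interval I \<and> (\<forall>t\<in>I. (y has_vector_derivative f (y t)) (at t))"

definition first_integral :: "('a::real_normed_vector \<Rightarrow> 'a) \<Rightarrow> ('a \<Rightarrow> real) \<Rightarrow> bool" where
  "first_integral f H \<longleftrightarrow>
     (\<forall>I y. ode_solution f I y \<longrightarrow> (\<forall>s\<in>I. \<forall>t\<in>I. H (y s) = H (y t)))"

text \<open>\<open>independent\<close> concerns sets, so injectivity is needed to speak about the indexed family.\<close>

definition independent_functions :: "(nat \<Rightarrow> 'a::real_inner \<Rightarrow> real) \<Rightarrow> nat \<Rightarrow> bool" where
  "independent_functions H q \<longleftrightarrow>
     (\<forall>y. inj_on (\<lambda>j. grad (H j) y) {1..q} \<and> independent ((\<lambda>j. grad (H j) y) ` {1..q}))"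

definition projection_onto :: "'a::real_vector set \<Rightarrow> ('a \<Rightarrow> 'a) \<Rightarrow> bool" where
  "projection_onto V P \<longleftrightarrow> linear P \<and> P \<circ> P = P \<and> range P = V"

text \<open>\<open>\<Phi>\<close> represents the possibly implicit one-step scheme
  \<open>y\<^sup>n\<^sup>+\<^sup>1 = \<Phi> h y\<^sup>n y\<^sup>n\<^sup>+\<^sup>1\<close>; its order is measured by the defect of exact solutions.\<close>

definition has_order ::
  "('a::real_normed_vector \<Rightarrow> 'a) \<Rightarrow> (real \<Rightarrow> 'a \<Rightarrow> 'a \<Rightarrow> 'a) \<Rightarrow> nat \<Rightarrow> bool" where
  "has_order f \<Phi> p \<longleftrightarrow>
     (\<forall>I y. ode_solution f I y \<longrightarrow>
       (\<forall>t\<in>I. (\<lambda>h. norm (y (t + h) - \<Phi> h (y t) (y (t + h)))) \<in> O[at 0](\<lambda>h. h ^ (p + 1))))"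

end

theory Submission
  imports Defs
begin

text \<open>The increment \<open>y (t + h) - y t\<close> of an exact solution is a discrete tangent vector, since the
  first integrals do not change along the solution, so it is fixed by the projection. The defect of
  the projected scheme is therefore the projection of the defect of the underlying scheme, and the
  projections are bounded near the diagonal.\<close>

lemma projection_onto_fixes:
  assumes "projection_onto V P" and "x \<in> V"
  shows "P x = x"
  using assms unfolding projection_onto_def by (metis comp_apply rangeE)

text \<open>Keeping \<open>\<Phi>\<close> arbitrary lets one estimate serve both schemes. The first
  integrals enter only through \<open>fixed\<close>, which says that \<open>P\<close> leaves
  increments of exact solutions unchanged; continuity on the open set \<open>N\<close> around the
  diagonal supplies the local bound on \<open>P\<close>.\<close>

lemma has_order_project:
  fixes P :: "'a::real_normed_vector \<Rightarrow> 'a \<Rightarrow> 'a \<Rightarrow>\<^sub>L 'a"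
  assumes "has_order f \<Phi> p"
    and "open N" and diag: "\<And>y. (y, y) \<in> N"
    and cont: "continuous_on N (\<lambda>(v, u). P v u)"
    and fixed: "\<And>I y s t. \<lbrakk>ode_solution f I y; s \<in> I; t \<in> I; (y s, y t) \<in> N\<rbrakk>
      \<Longrightarrow> P (y s) (y t) (y t - y s) = y t - y s"
  shows "has_order f (\<lambda>h v u. v + P v u (\<Phi> h v u - v)) p"
  unfolding has_order_def
proof (intro allI impI ballI)
  fix I y t
  assume sol: "ode_solution f I y" and t: "t \<in> I"
  have "open I" and "isCont y t"
    using sol t by (auto simp: ode_solution_def intro: has_vector_derivative_continuous)
  have shift: "((\<lambda>h. t + h) \<longlongrightarrow> t) (at 0)"
    by (auto intro!: tendsto_eq_intros)
  then have "((\<lambda>h. y (t + h)) \<longlongrightarrow> y t) (at 0)"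
    by (rule isCont_tendsto_compose[OF \<open>isCont y t\<close>])
  then have lim: "((\<lambda>h. (y t, y (t + h))) \<longlongrightarrow> (y t, y t)) (at 0)"
    by (intro tendsto_intros)
  \<comment> \<open>\<open>fixed\<close> applies only while \<open>t + h\<close> stays in
    \<open>I\<close> and the pair of points stays in \<open>N\<close>; both hold for all small
    \<open>h\<close>, of either sign, because these sets are open.\<close>
  have in_I: "\<forall>\<^sub>F h in at 0. t + h \<in> I"
    using topological_tendstoD[OF shift \<open>open I\<close> t] .
  have in_N: "\<forall>\<^sub>F h in at 0. (y t, y (t + h)) \<in> N"
    using topological_tendstoD[OF lim \<open>open N\<close> diag] .
  have "isCont (\<lambda>(v, u). P v u) (y t, y t)"
    using cont \<open>open N\<close> diag by (simp add: continuous_on_eq_continuous_at)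
  from isCont_tendsto_compose[OF this lim]
  have "((\<lambda>h. norm (P (y t) (y (t + h)))) \<longlongrightarrow> norm (P (y t) (y t))) (at 0)"
    by (auto intro: tendsto_norm)
  \<comment> \<open>The operator norms converge to the norm at the diagonal point, so they
    eventually stay below that limit plus 1. This makes the constant independent of
    \<open>h\<close>.\<close>
  then have bound: "\<forall>\<^sub>F h in at 0. norm (P (y t) (y (t + h))) < norm (P (y t) (y t)) + 1"
    by (rule order_tendstoD) simp
  have "\<forall>\<^sub>F h in at 0.
      norm (norm (y (t + h) - (y t + P (y t) (y (t + h)) (\<Phi> h (y t) (y (t + h)) - y t))))
      \<le> (norm (P (y t) (y t)) + 1) * norm (norm (y (t + h) - \<Phi> h (y t) (y (t + h))))"
    using in_I in_N bound
  proof eventually_elim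
    case (elim h)
    let ?P = "P (y t) (y (t + h))" and ?\<Phi> = "\<Phi> h (y t) (y (t + h))"
    \<comment> \<open>The exact increment is replaced by its own image under \<open>?P\<close>;
      linearity then cancels \<open>y t\<close> and leaves \<open>?P\<close> applied to the defect
      of \<open>\<Phi>\<close>.\<close>
    have "y (t + h) - (y t + ?P (?\<Phi> - y t)) = ?P (y (t + h) - y t) - ?P (?\<Phi> - y t)"
      using fixed[OF sol t elim(1,2)] by simp
    also have "\<dots> = ?P (y (t + h) - ?\<Phi>)"
      by (simp flip: blinfun.diff_right)
    finally have "norm (y (t + h) - (y t + ?P (?\<Phi> - y t))) \<le> norm ?P * norm (y (t + h) - ?\<Phi>)"
      by (simp add: norm_blinfun)
    also have "\<dots> \<le> (norm (P (y t) (y t)) + 1) * norm (y (t + h) - ?\<Phi>)"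
      using elim(3) by (intro mult_right_mono) auto
    finally show ?case
      by simp
  qed
  then have "(\<lambda>h. norm (y (t + h) - (y t + P (y t) (y (t + h)) (\<Phi> h (y t) (y (t + h)) - y t))))
      \<in> O[at 0](\<lambda>h. norm (y (t + h) - \<Phi> h (y t) (y (t + h))))"
    by (rule bigoI)
  also have "(\<lambda>h. norm (y (t + h) - \<Phi> h (y t) (y (t + h)))) \<in> O[at 0](\<lambda>h. h ^ (p + 1))"
    using assms(1) sol t unfolding has_order_def by blast
  finally show "(\<lambda>h. norm (y (t + h) - (y t + P (y t) (y (t + h)) (\<Phi> h (y t) (y (t + h)) - y t))))
      \<in> O[at 0](\<lambda>h. h ^ (p + 1))" .
qed

text \<open>The defining identity of a discrete gradient turns each inner product into a difference
  of values of \<open>H j\<close>, which vanishes because both points lie on one solution.\<close>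

lemma solution_increment_in_discrete_tangent_space:
  assumes "\<forall>j\<in>{1..q}. first_integral f (H j)"
    and "\<forall>j\<in>{1..q}. discrete_gradient (H j) (DG (H j))"
    and "ode_solution f I y" "s \<in> I" "t \<in> I"
  shows "y t - y s \<in> discrete_tangent_space DG H q (y s) (y t)"
  unfolding discrete_tangent_space_def
proof (intro CollectI ballI)
  fix j assume j: "j \<in> {1..q}"
  have "DG (H j) (y s) (y t) \<bullet> (y t - y s) = H j (y t) - H j (y s)"
    using assms(2) j unfolding discrete_gradient_def by metis
  also have "\<dots> = 0"
    using assms(1,3-5) j unfolding first_integral_def by (metis diff_self)
  finally show "DG (H j) (y s) (y t) \<bullet> (y t - y s) = 0" .
qed

theorem theorem2p4:
  fixes f :: "(real ^ 'm) \<Rightarrow> (real ^ 'm)"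
    and H :: "nat \<Rightarrow> (real ^ 'm) \<Rightarrow> real"
    and q p :: nat
    and DG :: "((real ^ 'm) \<Rightarrow> real) \<Rightarrow> (real ^ 'm) \<Rightarrow> (real ^ 'm) \<Rightarrow> (real ^ 'm)"
    and P :: "(real ^ 'm) \<Rightarrow> (real ^ 'm) \<Rightarrow> (real ^ 'm) \<Rightarrow>\<^sub>L (real ^ 'm)"
    and N :: "((real ^ 'm) \<times> (real ^ 'm)) set"
    and \<phi> :: "real \<Rightarrow> (real ^ 'm) \<Rightarrow> (real ^ 'm)"
    and \<psi> :: "real \<Rightarrow> (real ^ 'm) \<Rightarrow> (real ^ 'm) \<Rightarrow> (real ^ 'm)"
  assumes "smooth_on UNIV f"
    and "q \<ge> 1"
    and "\<forall>j\<in>{1..q}. first_integral f (H j)"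
    and "independent_functions H q"
    and "\<forall>j\<in>{1..q}. discrete_gradient (H j) (DG (H j))"
    and "open N" and "\<forall>y. (y, y) \<in> N"
    and "\<forall>(v, u)\<in>N. projection_onto (discrete_tangent_space DG H q v u) (blinfun_apply (P v u))"
    and "smooth_on N (\<lambda>(v, u). P v u)"
    and "has_order f (\<lambda>h v u. \<phi> h v) p"
    and "has_order f (\<lambda>h v u. v + h *\<^sub>R \<psi> h v u) p"
  shows "has_order f (\<lambda>h v u. v + P v u (\<phi> h v - v)) p
       \<and> has_order f (\<lambda>h v u. v + h *\<^sub>R P v u (\<psi> h v u)) p"
proof -
  \<comment> \<open>This is the case \<open>k = 0\<close> of smoothness.\<close>
  have "continuous_on N (\<lambda>(v, u). P v u)"
    using assms(9) unfolding smooth_on_def by (metis Ck_on.simps(1))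
  moreover have "P (y s) (y t) (y t - y s) = y t - y s"
    if "ode_solution f I y" "s \<in> I" "t \<in> I" "(y s, y t) \<in> N" for I y s t
    using projection_onto_fixes[of "discrete_tangent_space DG H q (y s) (y t)"] assms(8) that
      solution_increment_in_discrete_tangent_space[OF assms(3,5) that(1-3)] by blast
  ultimately have project: "has_order f (\<lambda>h v u. v + P v u (\<Phi> h v u - v)) p"
    if "has_order f \<Phi> p" for \<Phi>
    using that assms(6,7) by (intro has_order_project) auto
  show ?thesis
    \<comment> \<open>In the second instance \<open>\<Phi> h v u - v\<close> is
      \<open>h *\<^sub>R \<psi> h v u\<close>, and linearity moves the factor \<open>h\<close> out
      of \<open>P v u\<close>.\<close>
    using project[OF assms(10)] project[OF assms(11)] by (simp add: blinfun.scaleR_right)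
qed

end
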